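(* Let $(X,h,A)$ be a triple (as defined in the context) with distinguished fundamental domain $F_{\mathbb{1}}\subseteq X$. Let $G$ be a group acting on the set $X$ such that the action of $G$ commutes with the action of $A$, and suppose that there is a universal constant $C_0$ such that for every $g\in G$ there is a real number $r=r(g)$ with $h(g(F_{\mathbb{1}}))\subseteq [r,r+C_0]$. Let $a\in X$. Then the function $\mu:G\to\mathbb{R}$, $\mu(g)=h(g\cdot a)-h(a)$, is a quasimorphism on $G$.
   Context: A quasimorphism on a group $G$ is a function $\mu:G\to\mathbb{R}$ for which there is a constant $B$ with $|\mu(xy)-\mu(x)-\mu(y)|\le B$ for all $x,y\in G$. A triple $(X,h,A)$ consists of a (nonempty) set $X$ with no special structure, a group $A$ (with identity $\mathbb{1}$) acting on $X$, and a function $h:X\to\mathbb{R}$, such that: (i) $X=\coprod_{\alpha\in A}F_\alpha$ is a disjoint union of subsets $F_\alpha$ ("fundamental domains") indexed by $A$; (ii) for every $\alpha\in A$, the action of $\alpha$ restricts to a bijection $\alpha:F_{\mathbb{1}}\to F_\alpha$; (iii) $h(F_{\mathbb{1}})\subseteq[0,1)$; (iv) there are an unbounded homomorphism $\rho:A\to\mathbb{Z}$ and a bounded function $b:F_{\mathbb{1}}\times A\to\mathbb{R}$ such that $h(\alpha(x))=h(x)+\rho(\alpha)+b(x,\alpha)$ for all $x\in F_{\mathbb{1}}$ and $\alpha\in A$. *)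

theory Defs
  imports Complex_Main "HOL-Library.Disjoint_Sets" "HOL-Algebra.Group_Action"
    "HOL-Algebra.Elementary_Groups"
begin

locale quasimorphism = group G for G :: "('g, 'm) monoid_scheme" (structure) +
  fixes \<mu> :: "'g \<Rightarrow> real"
  assumes bounded_defect:
    "\<exists>B. \<forall>x \<in> carrier G. \<forall>y \<in> carrier G. \<bar>\<mu> (x \<otimes> y) - \<mu> x - \<mu> y\<bar> \<le> B"

(* The data of the triple (X, h, A): the set X is a carrier set, the action of A on X is the
   homomorphism \<phi> from A to the group of bijections of X, and F \<alpha> is the fundamental domain
   indexed by \<alpha>.  The values of F outside the carrier of A and of h outside X are irrelevant. *)
locale fundamental_triple =
  group_action A X \<phi>
  for A :: "('a, 'n) monoid_scheme" (structure) and X :: "'x set" and \<phi> :: "'a \<Rightarrow> 'x \<Rightarrow> 'x" +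
  fixes h :: "'x \<Rightarrow> real" and F :: "'a \<Rightarrow> 'x set"
  assumes nonempty: "X \<noteq> {}"
    and cover: "X = (\<Union>\<alpha> \<in> carrier A. F \<alpha>)"
    and disjoint: "disjoint_family_on F (carrier A)"
    and translate: "\<And>\<alpha>. \<alpha> \<in> carrier A \<Longrightarrow> bij_betw (\<phi> \<alpha>) (F \<one>) (F \<alpha>)"
    and height_range: "h ` F \<one> \<subseteq> {0..<1}"
    and height_translate:
      "\<exists>\<rho> \<in> hom A integer_group. \<exists>b :: 'x \<Rightarrow> 'a \<Rightarrow> real.
         (\<forall>N. \<exists>\<alpha> \<in> carrier A. \<bar>\<rho> \<alpha>\<bar> > N) \<and>
         (\<exists>K. \<forall>x \<in> F \<one>. \<forall>\<alpha> \<in> carrier A. \<bar>b x \<alpha>\<bar> \<le> K) \<and>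
         (\<forall>x \<in> F \<one>. \<forall>\<alpha> \<in> carrier A. h (\<phi> \<alpha> x) = h x + real_of_int (\<rho> \<alpha>) + b x \<alpha>)"

end

theory Submission
  imports Defs
begin

text \<open>
  For a map \<open>f\<close> of \<open>X\<close>, call \<open>h (f x) - h x\<close> the displacement of the point \<open>x\<close> under \<open>f\<close>.
  The proof shows that the displacement under an element \<open>g\<close> of \<open>G\<close> is independent of the point up
  to an error that is uniform in \<open>g\<close>. This suffices, because the defect of \<open>\<mu>\<close> is a difference of
  two displacements under the same group element:
  \[\mu(gk) - \mu(g) - \mu(k) = (h(gka) - h(ka)) - (h(ga) - h(a)).\]

  The height formula of the triple is given for points of the distinguished fundamental domain only.
  Since \<open>\<rho>\<close> is additive and the fundamental domains cover \<open>X\<close>, it holds, up to a bounded error, at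
  every point (\<open>height_translate_everywhere\<close>): each \<open>\<alpha>\<close> in \<open>A\<close> moves all heights by
  approximately \<open>\<rho> \<alpha>\<close>. As the action of \<open>g\<close> commutes with that of \<open>\<alpha>\<close>, the points \<open>x\<close> and
  \<open>\<alpha> x\<close> have approximately the same displacement under \<open>g\<close>, and any two points can be moved into
  the distinguished domain. There \<open>h\<close> varies by at most 1, and its values after applying \<open>g\<close> vary by
  at most the universal constant of the hypothesis (\<open>displacement_uniform\<close>).
\<close>

context fundamental_triple
begin

lemma base_domain_subset: "F \<one> \<subseteq> X"
proof -
  interpret A: group A using group_hom group_hom.axioms(1) by blast
  show ?thesis using cover A.one_closed by blast
qed

lemma ex_translate_from_base_domain:
  assumes "x \<in> X"
  obtains \<alpha> z where "\<alpha> \<in> carrier A" "z \<in> F \<one>" "x = \<phi> \<alpha> z"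
proof -
  obtain \<alpha> where \<alpha>: "\<alpha> \<in> carrier A" and "x \<in> F \<alpha>"
    using assms cover by blast
  then obtain z where "z \<in> F \<one>" "x = \<phi> \<alpha> z"
    using bij_betw_imp_surj_on[OF translate[OF \<alpha>]] by blast
  with \<alpha> show thesis by (rule that)
qed

text \<open>
  Writing \<open>x = \<beta> z\<close> with \<open>z\<close> in the distinguished domain, the height formula at \<open>z\<close> applies to both
  \<open>\<alpha>\<beta>\<close> and \<open>\<beta>\<close>; in the difference of the two, additivity of \<open>\<rho>\<close> leaves \<open>\<rho> \<alpha>\<close> and two error
  terms.
\<close>
lemma height_translate_everywhere:
  "\<exists>(\<rho> :: 'a \<Rightarrow> int) K. \<forall>x \<in> X. \<forall>\<alpha> \<in> carrier A. \<bar>h (\<phi> \<alpha> x) - h x - of_int (\<rho> \<alpha>)\<bar> \<le> K"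
proof -
  interpret A: group A using group_hom group_hom.axioms(1) by blast
  obtain \<rho> b K where \<rho>: "\<rho> \<in> hom A integer_group"
    and K: "\<And>x \<alpha>. x \<in> F \<one> \<Longrightarrow> \<alpha> \<in> carrier A \<Longrightarrow> \<bar>b x \<alpha>\<bar> \<le> (K :: real)"
    and b: "\<And>x \<alpha>. x \<in> F \<one> \<Longrightarrow> \<alpha> \<in> carrier A \<Longrightarrow>
      h (\<phi> \<alpha> x) = h x + real_of_int (\<rho> \<alpha>) + b x \<alpha>"
    using height_translate by blast
  have "\<bar>h (\<phi> \<alpha> x) - h x - of_int (\<rho> \<alpha>)\<bar> \<le> 2 * K" if "x \<in> X" "\<alpha> \<in> carrier A" for x \<alpha>
  proof -
    obtain \<beta> z where \<beta>: "\<beta> \<in> carrier A" and z: "z \<in> F \<one>" and x: "x = \<phi> \<beta> z"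
      using ex_translate_from_base_domain[OF \<open>x \<in> X\<close>] .
    have "\<alpha> \<otimes> \<beta> \<in> carrier A" using that \<beta> by simp
    moreover have "\<phi> \<alpha> x = \<phi> (\<alpha> \<otimes> \<beta>) z"
      using composition_rule[of z \<alpha> \<beta>] base_domain_subset z \<beta> that x by auto
    moreover have "\<rho> (\<alpha> \<otimes> \<beta>) = \<rho> \<alpha> + \<rho> \<beta>"
      using hom_mult[OF \<rho>] that \<beta> by simp
    ultimately have "h (\<phi> \<alpha> x) - h x - of_int (\<rho> \<alpha>) = b z (\<alpha> \<otimes> \<beta>) - b z \<beta>"
      using b[OF z] \<beta> x by simp
    then show ?thesis
      using K[OF z \<open>\<alpha> \<otimes> \<beta> \<in> carrier A\<close>] K[OF z \<beta>] by linarith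
  qed
  then show ?thesis by blast
qed

text \<open>
  The bound is chosen before the map \<open>f\<close>: it depends on the triple and on \<open>C\<close> only. This is what
  gives a single bound for the defect when \<open>f\<close> ranges over a whole group.
\<close>
lemma displacement_uniform:
  fixes C :: real
  shows "\<exists>D. \<forall>f r x y. f ` X \<subseteq> X \<longrightarrow> (\<forall>\<alpha> \<in> carrier A. \<forall>x \<in> X. f (\<phi> \<alpha> x) = \<phi> \<alpha> (f x)) \<longrightarrow>
    h ` (f ` F \<one>) \<subseteq> {r..r + C} \<longrightarrow> x \<in> X \<longrightarrow> y \<in> X \<longrightarrow>
    \<bar>(h (f x) - h x) - (h (f y) - h y)\<bar> \<le> D"
proof -
  obtain \<rho> :: "'a \<Rightarrow> int" and K where
    K: "\<And>x \<alpha>. x \<in> X \<Longrightarrow> \<alpha> \<in> carrier A \<Longrightarrow> \<bar>h (\<phi> \<alpha> x) - h x - of_int (\<rho> \<alpha>)\<bar> \<le> K"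
    using height_translate_everywhere by blast
  have "\<bar>(h (f x) - h x) - (h (f y) - h y)\<bar> \<le> C + 1 + 4 * K"
    if f: "f ` X \<subseteq> X" and comm: "\<forall>\<alpha> \<in> carrier A. \<forall>x \<in> X. f (\<phi> \<alpha> x) = \<phi> \<alpha> (f x)"
      and r: "h ` (f ` F \<one>) \<subseteq> {r..r + C}" and "x \<in> X" "y \<in> X" for f r x y
  proof -
    have reduce: "\<exists>z \<in> F \<one>. \<bar>(h (f u) - h u) - (h (f z) - h z)\<bar> \<le> 2 * K" if "u \<in> X" for u
    proof -
      obtain \<alpha> z where \<alpha>: "\<alpha> \<in> carrier A" and z: "z \<in> F \<one>" and u: "u = \<phi> \<alpha> z"
        using ex_translate_from_base_domain[OF \<open>u \<in> X\<close>] .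
      have zX: "z \<in> X" using z base_domain_subset by blast
      then have "f z \<in> X" using f by blast
      moreover have "f u = \<phi> \<alpha> (f z)" using comm \<alpha> zX u by blast
      ultimately have "\<bar>h (f u) - h (f z) - of_int (\<rho> \<alpha>)\<bar> \<le> K"
        using K[OF _ \<alpha>] by simp
      then have "\<bar>(h (f u) - h u) - (h (f z) - h z)\<bar> \<le> 2 * K"
        using K[OF zX \<alpha>] unfolding u by linarith
      then show ?thesis using z by blast
    qed
    obtain v w where "v \<in> F \<one>" "w \<in> F \<one>"
      and vw: "\<bar>(h (f x) - h x) - (h (f v) - h v)\<bar> \<le> 2 * K"
        "\<bar>(h (f y) - h y) - (h (f w) - h w)\<bar> \<le> 2 * K"
      using reduce[OF \<open>x \<in> X\<close>] reduce[OF \<open>y \<in> X\<close>] by blast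
    then have "h v \<in> {0..<1}" "h w \<in> {0..<1}" "h (f v) \<in> {r..r + C}" "h (f w) \<in> {r..r + C}"
      using height_range r by blast+
    then have "\<bar>(h (f v) - h v) - (h (f w) - h w)\<bar> \<le> C + 1"
      unfolding atLeastAtMost_iff atLeastLessThan_iff by linarith
    with vw show ?thesis by linarith
  qed
  then show ?thesis by blast
qed

end

theorem theorem2p4:
  fixes A :: "('a, 'n) monoid_scheme" and X :: "'x set" and \<phi> :: "'a \<Rightarrow> 'x \<Rightarrow> 'x"
    and h :: "'x \<Rightarrow> real" and F :: "'a \<Rightarrow> 'x set"
    and G :: "('g, 'm) monoid_scheme" and \<psi> :: "'g \<Rightarrow> 'x \<Rightarrow> 'x" and a :: 'x
  assumes "fundamental_triple A X \<phi> h F"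
    and "group_action G X \<psi>"
    and "\<And>g \<alpha> x. g \<in> carrier G \<Longrightarrow> \<alpha> \<in> carrier A \<Longrightarrow> x \<in> X \<Longrightarrow> \<psi> g (\<phi> \<alpha> x) = \<phi> \<alpha> (\<psi> g x)"
    and "\<exists>C\<^sub>0 :: real. \<forall>g \<in> carrier G. \<exists>r :: real. h ` (\<psi> g ` F \<one>\<^bsub>A\<^esub>) \<subseteq> {r..r + C\<^sub>0}"
    and "a \<in> X"
  shows "quasimorphism G (\<lambda>g. h (\<psi> g a) - h a)"
proof -
  interpret fundamental_triple A X \<phi> h F by fact
  interpret act: group_action G X \<psi> by fact
  interpret G: group G using act.group_hom group_hom.axioms(1) by blast
  obtain C :: real where C: "\<forall>g \<in> carrier G. \<exists>r :: real. h ` (\<psi> g ` F \<one>\<^bsub>A\<^esub>) \<subseteq> {r..r + C}"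
    using assms(4) by blast
  obtain D where D: "\<And>f r x y. f ` X \<subseteq> X \<Longrightarrow>
      \<forall>\<alpha> \<in> carrier A. \<forall>x \<in> X. f (\<phi> \<alpha> x) = \<phi> \<alpha> (f x) \<Longrightarrow>
      h ` (f ` F \<one>\<^bsub>A\<^esub>) \<subseteq> {r..r + C} \<Longrightarrow> x \<in> X \<Longrightarrow> y \<in> X \<Longrightarrow>
      \<bar>(h (f x) - h x) - (h (f y) - h y)\<bar> \<le> D"
    using displacement_uniform[of C] by blast
  show ?thesis
  proof (unfold_locales, intro exI ballI)
    fix g k assume g: "g \<in> carrier G" and k: "k \<in> carrier G"
    have "\<psi> k a \<in> X" using act.element_image k \<open>a \<in> X\<close> by blast
    have "\<psi> g ` X \<subseteq> X" using act.element_image g by blast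
    moreover have "\<forall>\<alpha> \<in> carrier A. \<forall>x \<in> X. \<psi> g (\<phi> \<alpha> x) = \<phi> \<alpha> (\<psi> g x)"
      using assms(3) g by blast
    moreover obtain r where "h ` (\<psi> g ` F \<one>\<^bsub>A\<^esub>) \<subseteq> {r..r + C}" using C g by blast
    ultimately have "\<bar>(h (\<psi> g (\<psi> k a)) - h (\<psi> k a)) - (h (\<psi> g a) - h a)\<bar> \<le> D"
      by (rule D[OF _ _ _ \<open>\<psi> k a \<in> X\<close> \<open>a \<in> X\<close>])
    moreover have "\<psi> (g \<otimes>\<^bsub>G\<^esub> k) a = \<psi> g (\<psi> k a)"
      using act.composition_rule \<open>a \<in> X\<close> g k by blast
    ultimately show "\<bar>h (\<psi> (g \<otimes>\<^bsub>G\<^esub> k) a) - h a - (h (\<psi> g a) - h a) - (h (\<psi> k a) - h a)\<bar> \<le> D"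
      by (simp add: algebra_simps)
  qed
qed

end
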